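(* Let $n\ge1$, $X=\{1,\ldots,n\}$, let $S$ be (the vertex set of) a permutograph on $S_n$, and let $F:S\to X$. The following are equivalent: (i) $F$ is a discrete piecewise linear function; (ii) $F$ satisfies the separation property; (iii) $F$ is a polynomial on $S$.
   Context: A permutation $\alpha$ of $X$ is written $\alpha=(x_1\cdots x_n)$ with $x_k=k\alpha$ (permutations act on the right and are composed left to right). It defines the linear order $<_\alpha$ on $X$: $x_i<_\alpha x_j\iff i<j$; $\le_\alpha,\ge_\alpha$ accordingly. The distance $d(\alpha,\beta)$ is the number of pairs $\{x,y\}\subseteq X$ appearing in reverse order in $\alpha$ and $\beta$. An ordered partition of $(X,<)$ is a partition $\pi=(X_1,\ldots,X_m)$ into nonempty sets with $x<y$ whenever $x\in X_i,y\in X_j,i<j$; it is trivial if it is $(\{1\},\ldots,\{n\})$. For nontrivial $\pi$, $\tau_\pi$ reverses the order of elements within each block. $\alpha,\beta$ are $\pi$-adjacent if $\alpha\beta^{-1}=\tau_\pi$ for a nontrivial ordered partition $\pi$, adjacent if $\pi$-adjacent for some $\pi$. The big permutograph $\Upsilon_n$ is the graph on $S_n$ with edges the adjacent pairs, edge $\alpha\beta$ weighted by $d(\alpha,\beta)$; a permutograph on $S_n$ is an isometric weighted subgraph of $\Upsilon_n$ (minimum path weight between any two of its vertices inside the subgraph equals that in $\Upsilon_n$, namely $d(\alpha,\beta)$). For $Y\subseteq X$, $Y\alpha=\{y\alpha:y\in Y\}$. $F$ is a discrete piecewise linear function if for any two $\pi$-adjacent $\alpha,\beta\in S$ with $\pi=(X_1,\ldots,X_m)$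 there is $i$ with $F(\alpha)\in X_i\alpha$ and $F(\beta)\in X_i\beta$. $F$ satisfies the separation property if for all $\alpha,\beta\in S$ there is $u\in X$ with $u\le_\alpha F(\alpha)$ and $u\ge_\beta F(\beta)$. With $G_k:S\to X$ the constant function $G_k(\alpha)=k$, $F$ is a polynomial on $S$ if there is a family $\{K_i\}_{i\in I}$ of subsets of $X$ ($I$ and each $K_i$ nonempty) such that $F(\alpha)=\bigvee_{i\in I}\bigwedge_{j\in K_i}G_j(\alpha)$ for all $\alpha\in S$, meets and joins taken with respect to $\le_\alpha$. *)

theory Defs
  imports
    "HOL-Combinatorics.Permutations"
    "HOL-Library.Disjoint_Sets"
    "HOL-Algebra.Lattice"
    "Graph_Theory.Graph_Theory"
begin

text \<open>
  The ground set is \<open>{1..n}\<close> and a permutation \<open>\<alpha>\<close> of it is a function with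
  \<open>\<alpha> permutes {1..n}\<close>. As permutations act on the right, \<open>k\<alpha>\<close> is \<open>\<alpha> k\<close>, so
  \<open>x\<^sub>k = \<alpha> k\<close>, the position of \<open>x\<close> in \<open>\<alpha>\<close> is \<open>inv \<alpha> x\<close>, and the left-to-right product
  \<open>\<alpha>\<beta>\<close> is \<open>\<beta> \<circ> \<alpha>\<close>.
\<close>

definition perm_less :: "(nat \<Rightarrow> nat) \<Rightarrow> nat \<Rightarrow> nat \<Rightarrow> bool" where
  "perm_less \<alpha> x y \<longleftrightarrow> inv \<alpha> x < inv \<alpha> y"

definition perm_le :: "(nat \<Rightarrow> nat) \<Rightarrow> nat \<Rightarrow> nat \<Rightarrow> bool" where
  "perm_le \<alpha> x y \<longleftrightarrow> inv \<alpha> x \<le> inv \<alpha> y"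

definition perm_order :: "nat \<Rightarrow> (nat \<Rightarrow> nat) \<Rightarrow> nat gorder" where
  "perm_order n \<alpha> = \<lparr>carrier = {1..n}, eq = (=), le = perm_le \<alpha>\<rparr>"

definition perm_dist :: "nat \<Rightarrow> (nat \<Rightarrow> nat) \<Rightarrow> (nat \<Rightarrow> nat) \<Rightarrow> nat" where
  "perm_dist n \<alpha> \<beta> =
     card {{x, y} | x y. x \<in> {1..n} \<and> y \<in> {1..n} \<and> perm_less \<alpha> x y \<and> perm_less \<beta> y x}"

definition ordered_partition :: "nat \<Rightarrow> nat set list \<Rightarrow> bool" where
  "ordered_partition n \<pi> \<longleftrightarrow>
     partition_on {1..n} (set \<pi>) \<and> sorted_wrt (\<lambda>A B. \<forall>x\<in>A. \<forall>y\<in>B. x < y) \<pi>"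

definition trivial_partition :: "nat \<Rightarrow> nat set list" where
  "trivial_partition n = map (\<lambda>k. {k}) [1..<Suc n]"

text \<open>
  The blocks of an ordered partition are intervals, so \<open>x \<mapsto> Min B + Max B - x\<close> reverses the
  block \<open>B\<close>; see \<open>block_reversal_permutes\<close>, \<open>block_reversal_image\<close> and
  \<open>block_reversal_reverses\<close> below.
\<close>

definition block_of :: "nat set list \<Rightarrow> nat \<Rightarrow> nat set" where
  "block_of \<pi> x = (THE B. B \<in> set \<pi> \<and> x \<in> B)"

definition block_reversal :: "nat set list \<Rightarrow> nat \<Rightarrow> nat" where
  "block_reversal \<pi> x =
     (if x \<in> \<Union> (set \<pi>) then Min (block_of \<pi> x) + Max (block_of \<pi> x) - x else x)"

definition partition_adjacent ::
    "nat \<Rightarrow> nat set list \<Rightarrow> (nat \<Rightarrow> nat) \<Rightarrow> (nat \<Rightarrow> nat) \<Rightarrow> bool" where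
  "partition_adjacent n \<pi> \<alpha> \<beta> \<longleftrightarrow>
     ordered_partition n \<pi> \<and> \<pi> \<noteq> trivial_partition n \<and> inv \<beta> \<circ> \<alpha> = block_reversal \<pi>"

definition perm_adjacent :: "nat \<Rightarrow> (nat \<Rightarrow> nat) \<Rightarrow> (nat \<Rightarrow> nat) \<Rightarrow> bool" where
  "perm_adjacent n \<alpha> \<beta> \<longleftrightarrow> (\<exists>\<pi>. partition_adjacent n \<pi> \<alpha> \<beta>)"

text \<open>
  Undirected graphs are symmetric loop-free digraphs (locale \<open>pair_graph\<close>), each edge being a
  pair of opposite arcs.
\<close>

definition big_permutograph :: "nat \<Rightarrow> (nat \<Rightarrow> nat) pair_pre_digraph" where
  "big_permutograph n =
     \<lparr>pverts = {\<alpha>. \<alpha> permutes {1..n}},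
      parcs = {(\<alpha>, \<beta>). \<alpha> permutes {1..n} \<and> \<beta> permutes {1..n} \<and> perm_adjacent n \<alpha> \<beta>}\<rparr>"

definition edge_weight :: "nat \<Rightarrow> ((nat \<Rightarrow> nat) \<times> (nat \<Rightarrow> nat)) weight_fun" where
  "edge_weight n e = real (perm_dist n (fst e) (snd e))"

text \<open>
  The function \<open>wf_digraph.\<mu>\<close> is the infimum of the weights of all walks between two vertices.
  The weights are natural numbers, so it is a minimum, and it is \<open>\<infinity>\<close> if there is no walk.
\<close>

definition permutograph :: "nat \<Rightarrow> (nat \<Rightarrow> nat) pair_pre_digraph \<Rightarrow> bool" where
  "permutograph n H \<longleftrightarrow>
     pair_graph H \<and>
     subgraph (with_proj H) (with_proj (big_permutograph n)) \<and>
     (\<forall>\<alpha>\<in>pverts H. \<forall>\<beta>\<in>pverts H.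
        wf_digraph.\<mu> (with_proj H) (edge_weight n) \<alpha> \<beta> =
        wf_digraph.\<mu> (with_proj (big_permutograph n)) (edge_weight n) \<alpha> \<beta>)"

definition discrete_piecewise_linear ::
    "nat \<Rightarrow> (nat \<Rightarrow> nat) set \<Rightarrow> ((nat \<Rightarrow> nat) \<Rightarrow> nat) \<Rightarrow> bool" where
  "discrete_piecewise_linear n S F \<longleftrightarrow>
     (\<forall>\<alpha>\<in>S. \<forall>\<beta>\<in>S. \<forall>\<pi>. partition_adjacent n \<pi> \<alpha> \<beta> \<longrightarrow>
        (\<exists>i<length \<pi>. F \<alpha> \<in> \<alpha> ` (\<pi> ! i) \<and> F \<beta> \<in> \<beta> ` (\<pi> ! i)))"

definition separation_property ::
    "nat \<Rightarrow> (nat \<Rightarrow> nat) set \<Rightarrow> ((nat \<Rightarrow> nat) \<Rightarrow> nat) \<Rightarrow> bool" where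
  "separation_property n S F \<longleftrightarrow>
     (\<forall>\<alpha>\<in>S. \<forall>\<beta>\<in>S. \<exists>u\<in>{1..n}. perm_le \<alpha> u (F \<alpha>) \<and> perm_le \<beta> (F \<beta>) u)"

definition const_fn :: "nat \<Rightarrow> (nat \<Rightarrow> nat) \<Rightarrow> nat" where
  "const_fn k \<alpha> = k"

text \<open>
  The family of subsets is given as the set of its members; by idempotence of the join,
  repeated members are irrelevant.
\<close>

definition polynomial_on ::
    "nat \<Rightarrow> (nat \<Rightarrow> nat) set \<Rightarrow> ((nat \<Rightarrow> nat) \<Rightarrow> nat) \<Rightarrow> bool" where
  "polynomial_on n S F \<longleftrightarrow>
     (\<exists>\<K>. \<K> \<noteq> {} \<and> (\<forall>K\<in>\<K>. K \<noteq> {} \<and> K \<subseteq> {1..n}) \<and>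
        (\<forall>\<alpha>\<in>S. F \<alpha> =
           (SSUP\<^bsub>perm_order n \<alpha>\<^esub> K:\<K>. IINF\<^bsub>perm_order n \<alpha>\<^esub> j:K. const_fn j \<alpha>)))"

lemma block_of_eq:
  assumes "ordered_partition n \<pi>" "B \<in> set \<pi>" "x \<in> B"
  shows "block_of \<pi> x = B"
  unfolding block_of_def
proof (rule the_equality)
  show "C = B" if "C \<in> set \<pi> \<and> x \<in> C" for C
    using assms that by (auto simp: ordered_partition_def partition_on_def disjoint_def)
qed (use assms in auto)

lemma block_interval:
  assumes op: "ordered_partition n \<pi>" and B: "B \<in> set \<pi>"
  shows "finite B" "B \<noteq> {}" "z \<in> B \<longleftrightarrow> Min B \<le> z \<and> z \<le> Max B"
proof -
  have un: "\<Union> (set \<pi>) = {1..n}" and ne: "{} \<notin> set \<pi>"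
    using op unfolding ordered_partition_def partition_on_def by blast+
  have sub: "B \<subseteq> {1..n}" unfolding un[symmetric] using B by (rule Union_upper)
  then show fin: "finite B" by (rule finite_subset) simp
  show nonempty: "B \<noteq> {}" using ne B by metis
  have "z \<in> B" if z: "Min B \<le> z" "z \<le> Max B" for z
  proof -
    have m: "Min B \<in> B" "Max B \<in> B" using fin nonempty by simp_all
    then have "Min B \<in> {1..n}" "Max B \<in> {1..n}" by (simp_all only: subsetD[OF sub])
    then have "z \<in> \<Union> (set \<pi>)" unfolding un using z by simp
    then obtain C where C: "C \<in> set \<pi>" "z \<in> C" by (rule UnionE)
    obtain i j where i: "i < length \<pi>" "\<pi> ! i = B" and j: "j < length \<pi>" "\<pi> ! j = C"
      using B C(1) unfolding in_set_conv_nth by blast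
    have s: "\<forall>x\<in>\<pi> ! k. \<forall>y\<in>\<pi> ! l. x < y" if "k < l" "l < length \<pi>" for k l
      using op that unfolding ordered_partition_def sorted_wrt_iff_nth_less by blast
    consider "i < j" | "j < i" | "i = j" by linarith
    then show ?thesis
    proof cases
      case 1
      have "Max B < z" using s[OF 1 j(1)] m(2) C(2) unfolding i(2) j(2) by blast
      then show ?thesis using z by simp
    next
      case 2
      have "z < Min B" using s[OF 2 i(1)] m(1) C(2) unfolding i(2) j(2) by blast
      then show ?thesis using z by simp
    next
      case 3
      then show ?thesis using i(2) j(2) C(2) by metis
    qed
  qed
  then show "z \<in> B \<longleftrightarrow> Min B \<le> z \<and> z \<le> Max B" using fin Min_le Max_ge by blast
qed

lemma block_reversal_eq:
  assumes "ordered_partition n \<pi>" "B \<in> set \<pi>" "x \<in> B"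
  shows "block_reversal \<pi> x = Min B + Max B - x"
  using assms block_of_eq[OF assms] by (auto simp: block_reversal_def)

lemma block_reversal_in:
  assumes "ordered_partition n \<pi>" "B \<in> set \<pi>" "x \<in> B"
  shows "block_reversal \<pi> x \<in> B"
proof -
  have "Min B \<le> x" "x \<le> Max B" using block_interval(3)[OF assms(1,2)] assms(3) by auto
  then have "Min B + Max B - x \<in> B" unfolding block_interval(3)[OF assms(1,2)] by linarith
  then show ?thesis using block_reversal_eq[OF assms] by simp
qed

lemma block_reversal_involution:
  assumes "ordered_partition n \<pi>"
  shows "block_reversal \<pi> (block_reversal \<pi> x) = x"
proof (cases "x \<in> \<Union> (set \<pi>)")
  case True
  then obtain B where B: "B \<in> set \<pi>" "x \<in> B" by auto
  have "x \<le> Max B" using block_interval(3)[OF assms B(1)] B(2) by auto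
  then show ?thesis
    using block_reversal_eq[OF assms B] block_reversal_eq[OF assms B(1) block_reversal_in[OF assms B]]
    by simp
qed (simp add: block_reversal_def)

lemma block_reversal_permutes:
  assumes "ordered_partition n \<pi>"
  shows "block_reversal \<pi> permutes {1..n}"
  unfolding permutes_def
proof (intro conjI allI impI)
  show "block_reversal \<pi> x = x" if "x \<notin> {1..n}" for x
  proof -
    have "x \<notin> \<Union> (set \<pi>)"
      using that assms by (simp only: ordered_partition_def partition_on_def) blast
    then show ?thesis by (simp add: block_reversal_def)
  qed
  show "\<exists>!x. block_reversal \<pi> x = y" for y
    using block_reversal_involution[OF assms] by (intro ex1I[of _ "block_reversal \<pi> y"]) auto
qed

lemma block_reversal_image:
  assumes "ordered_partition n \<pi>" "B \<in> set \<pi>"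
  shows "block_reversal \<pi> ` B = B"
proof
  show "block_reversal \<pi> ` B \<subseteq> B" using block_reversal_in[OF assms] by auto
  show "B \<subseteq> block_reversal \<pi> ` B"
  proof
    fix x assume "x \<in> B"
    then show "x \<in> block_reversal \<pi> ` B"
      using block_reversal_in[OF assms] block_reversal_involution[OF assms(1)]
      by (intro image_eqI[of _ _ "block_reversal \<pi> x"]) simp_all
  qed
qed

lemma block_reversal_reverses:
  assumes "ordered_partition n \<pi>" "B \<in> set \<pi>" "x \<in> B" "y \<in> B" "x < y"
  shows "block_reversal \<pi> y < block_reversal \<pi> x"
proof -
  have "y \<le> Max B" using block_interval(3)[OF assms(1,2)] assms(4) by auto
  then show ?thesis
    using assms(5) block_reversal_eq[OF assms(1-3)] block_reversal_eq[OF assms(1,2,4)] by simp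
qed

end

theory Submission
  imports Defs
begin

text \<open>
  The separation property is the pivot. If it holds, the sets \<open>K\<^sub>\<beta> = {u. F \<beta> \<le>\<^sub>\<beta> u}\<close> present \<open>F\<close>
  as a polynomial; conversely a set \<open>K\<close> attaining the join at \<open>\<beta>\<close> has its \<open>\<alpha>\<close>-minimum as a
  separating element. For adjacent \<open>\<alpha>\<close>, \<open>\<beta>\<close> the map sending an element to its block is monotone for
  both orders, so separation applied to \<open>(\<alpha>, \<beta>)\<close> and \<open>(\<beta>, \<alpha>)\<close> puts \<open>F \<alpha>\<close> and \<open>F \<beta>\<close> in the same
  block. Finally, isometry provides a walk from \<open>\<alpha>\<close> to \<open>\<beta>\<close> of weight \<open>d(\<alpha>, \<beta>)\<close>, along which
  every pair is inverted at most once; this lets a separating element be carried back along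
  the walk, one edge at a time.
\<close>

section \<open>Inversions and distance\<close>

definition inversions :: "nat \<Rightarrow> (nat \<Rightarrow> nat) \<Rightarrow> (nat \<Rightarrow> nat) \<Rightarrow> (nat \<times> nat) set" where
  "inversions n \<alpha> \<beta> =
     {(x, y). x \<in> {1..n} \<and> y \<in> {1..n} \<and> perm_less \<alpha> x y \<and> perm_less \<beta> y x}"

lemma finite_inversions [simp]: "finite (inversions n \<alpha> \<beta>)"
  by (rule finite_subset[of _ "{1..n} \<times> {1..n}"]) (auto simp: inversions_def)

text \<open>Forgetting the orientation is injective on \<open>inversions\<close>, since \<alpha>
  puts only one of \<open>x\<close>, \<open>y\<close> first. Ordered pairs make it possible to say
  which element overtakes which.\<close>

lemma perm_dist_eq_card_inversions: "perm_dist n \<alpha> \<beta> = card (inversions n \<alpha> \<beta>)"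
proof -
  have "inj_on (\<lambda>(x, y). {x, y}) (inversions n \<alpha> \<beta>)"
    by (auto simp: inj_on_def inversions_def perm_less_def doubleton_eq_iff)
  moreover have "{{x, y} | x y. x \<in> {1..n} \<and> y \<in> {1..n} \<and> perm_less \<alpha> x y \<and> perm_less \<beta> y x} =
      (\<lambda>(x, y). {x, y}) ` inversions n \<alpha> \<beta>"
    unfolding inversions_def by auto
  ultimately show ?thesis unfolding perm_dist_def by (simp add: card_image)
qed

lemma inv_permutes_eq_iff:
  assumes "\<alpha> permutes A"
  shows "inv \<alpha> x = inv \<alpha> y \<longleftrightarrow> x = y"
  using permutes_inj[OF permutes_inv[OF assms]] by (simp add: inj_eq)

text \<open>The order \<beta> decides every pair of distinct elements one way or the other, so a
  reversal between \<alpha> and \<gamma> takes place either before or after \<beta>.\<close>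

lemma inversions_subset_Un:
  assumes "\<beta> permutes {1..n}"
  shows "inversions n \<alpha> \<gamma> \<subseteq> inversions n \<alpha> \<beta> \<union> inversions n \<beta> \<gamma>"
proof (rule subsetI, clarify)
  fix x y assume "(x, y) \<in> inversions n \<alpha> \<gamma>" "(x, y) \<notin> inversions n \<beta> \<gamma>"
  moreover from this have "x \<noteq> y" by (auto simp: inversions_def perm_less_def)
  then have "inv \<beta> x \<noteq> inv \<beta> y" using inv_permutes_eq_iff[OF assms] by simp
  ultimately show "(x, y) \<in> inversions n \<alpha> \<beta>" by (auto simp: inversions_def perm_less_def)
qed

lemma perm_dist_triangle:
  assumes "\<beta> permutes {1..n}"
  shows "perm_dist n \<alpha> \<gamma> \<le> perm_dist n \<alpha> \<beta> + perm_dist n \<beta> \<gamma>"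
  unfolding perm_dist_eq_card_inversions
  using card_mono[OF _ inversions_subset_Un[OF assms]] card_Un_le le_trans
  by (metis finite_UnI finite_inversions)

text \<open>A pair inverted before \<beta> and restored by \<gamma> would be counted in
  \<open>perm_dist n \<alpha> \<beta>\<close> without contributing to
  \<open>perm_dist n \<alpha> \<gamma>\<close>. Removing it from the covering union makes the
  triangle inequality strict, contrary to \<open>geodesic\<close>.\<close>

lemma inversion_on_geodesic_not_undone:
  assumes \<beta>: "\<beta> permutes {1..n}"
    and geodesic: "perm_dist n \<alpha> \<beta> + perm_dist n \<beta> \<gamma> \<le> perm_dist n \<alpha> \<gamma>"
    and xy: "(x, y) \<in> inversions n \<alpha> \<beta>"
  shows "perm_le \<gamma> y x"
proof (rule ccontr)
  assume "\<not> perm_le \<gamma> y x"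
  then have "(x, y) \<notin> inversions n \<alpha> \<gamma>" by (auto simp: inversions_def perm_le_def perm_less_def)
  moreover have "(x, y) \<notin> inversions n \<beta> \<gamma>"
    using xy by (auto simp: inversions_def perm_less_def)
  ultimately have "inversions n \<alpha> \<gamma> \<subseteq> (inversions n \<alpha> \<beta> - {(x, y)}) \<union> inversions n \<beta> \<gamma>"
    using inversions_subset_Un[OF \<beta>, of \<alpha> \<gamma>] by blast
  then have "card (inversions n \<alpha> \<gamma>) \<le> card ((inversions n \<alpha> \<beta> - {(x, y)}) \<union> inversions n \<beta> \<gamma>)"
    by (intro card_mono) auto
  also have "\<dots> \<le> card (inversions n \<alpha> \<beta> - {(x, y)}) + card (inversions n \<beta> \<gamma>)"
    by (rule card_Un_le)
  also have "\<dots> < card (inversions n \<alpha> \<beta>) + card (inversions n \<beta> \<gamma>)"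
    using card_Diff1_less[OF finite_inversions xy] by simp
  finally show False using geodesic by (simp add: perm_dist_eq_card_inversions)
qed

section \<open>Adjacency\<close>

lemma partition_adjacent_inv:
  assumes "partition_adjacent n \<pi> \<alpha> \<beta>" "\<alpha> permutes {1..n}"
  shows "inv \<beta> x = block_reversal \<pi> (inv \<alpha> x)"
proof -
  have "inv \<beta> x = (inv \<beta> \<circ> \<alpha>) (inv \<alpha> x)" using permutes_inverses(1)[OF assms(2)] by simp
  then show ?thesis using assms(1) unfolding partition_adjacent_def by metis
qed

text \<open>Reversal preserves each block, so an element has the same block index whether its
  position is read in \<alpha> or in \<beta>. Block indices can therefore be compared across the two
  orders.\<close>

lemma partition_adjacent_block_iff:
  assumes "partition_adjacent n \<pi> \<alpha> \<beta>" "\<alpha> permutes {1..n}" "B \<in> set \<pi>"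
  shows "inv \<beta> x \<in> B \<longleftrightarrow> inv \<alpha> x \<in> B"
proof -
  have op: "ordered_partition n \<pi>" using assms(1) by (simp add: partition_adjacent_def)
  show ?thesis
    using partition_adjacent_inv[OF assms(1,2)] block_reversal_in[OF op assms(3)]
      block_reversal_involution[OF op] by metis
qed

lemma in_image_permutes_iff:
  assumes "\<alpha> permutes A"
  shows "x \<in> \<alpha> ` B \<longleftrightarrow> inv \<alpha> x \<in> B"
  using permutes_inverses[OF assms] by (auto intro: image_eqI[of _ _ "inv \<alpha> x"])

lemma ordered_partition_nth_less:
  assumes "ordered_partition n \<pi>" "i < j" "j < length \<pi>" "x \<in> \<pi> ! i" "y \<in> \<pi> ! j"
  shows "x < y"
  using assms unfolding ordered_partition_def sorted_wrt_iff_nth_less by blast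

lemma ordered_partition_nth_le:
  assumes "ordered_partition n \<pi>" "i < length \<pi>" "x \<in> \<pi> ! i" "y \<in> \<pi> ! j" "x \<le> y"
  shows "i \<le> j"
  using ordered_partition_nth_less[OF assms(1) _ assms(2,4,3)] assms(5) by force

lemma ordered_partition_block:
  assumes "ordered_partition n \<pi>" "x \<in> {1..n}"
  obtains i where "i < length \<pi>" "x \<in> \<pi> ! i"
proof -
  have "x \<in> \<Union> (set \<pi>)" using assms by (simp only: ordered_partition_def partition_on_def)
  then show thesis using that by (auto simp: in_set_conv_nth)
qed

section \<open>Walks in the big permutograph\<close>

definition swap_partition :: "nat \<Rightarrow> nat \<Rightarrow> nat set list" where
  "swap_partition n k =
     map (\<lambda>i. {i}) [1..<k] @ [{k, Suc k}] @ map (\<lambda>i. {i}) [Suc (Suc k)..<Suc n]"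

lemma set_swap_partition:
  "set (swap_partition n k) = (\<lambda>i. {i}) ` {1..<k} \<union> {{k, Suc k}} \<union> (\<lambda>i. {i}) ` {Suc (Suc k)..n}"
  unfolding swap_partition_def by auto

lemma ordered_partition_swap_partition:
  assumes "k \<in> {1..<n}"
  shows "ordered_partition n (swap_partition n k)"
  unfolding ordered_partition_def
proof
  show "partition_on {1..n} (set (swap_partition n k))"
    unfolding set_swap_partition partition_on_def disjoint_def using assms by auto
  have s: "sorted_wrt (\<lambda>A B. \<forall>x\<in>A. \<forall>y\<in>B. x < y) (map (\<lambda>i. {i}) [a..<b])" for a b :: nat
    by (simp add: sorted_wrt_map)
  show "sorted_wrt (\<lambda>A B. \<forall>x\<in>A. \<forall>y\<in>B. x < y) (swap_partition n k)"
    unfolding swap_partition_def sorted_wrt_append by (intro conjI s) auto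
qed

text \<open>On the block \<open>{k, Suc k}\<close> the map \<open>Min B + Max B - x\<close>
  exchanges the two points, and on a singleton it is the identity. Hence every exchange of
  neighbours is an edge of the big permutograph.\<close>

lemma block_reversal_swap_partition:
  assumes "k \<in> {1..<n}"
  shows "block_reversal (swap_partition n k) = transpose k (Suc k)"
proof
  fix x
  note op = ordered_partition_swap_partition[OF assms]
  note eq = block_reversal_eq[OF op]
  consider "x \<notin> {1..n}" | "x = k \<or> x = Suc k" | "x \<in> {1..<k} \<union> {Suc (Suc k)..n}"
    by fastforce
  then show "block_reversal (swap_partition n k) x = transpose k (Suc k) x"
  proof cases
    case 1
    then show ?thesis
      using permutes_not_in[OF block_reversal_permutes[OF op] 1] assms by (auto simp: transpose_def)
  next
    case 2
    then show ?thesis using eq[of "{k, Suc k}" x] by (auto simp: set_swap_partition)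
  next
    case 3
    then show ?thesis using eq[of "{x}" x] by (auto simp: set_swap_partition transpose_def)
  qed
qed

lemma swap_partition_nontrivial: "swap_partition n k \<noteq> trivial_partition n"
proof
  assume "swap_partition n k = trivial_partition n"
  then have "{k, Suc k} \<in> set (trivial_partition n)"
    using set_swap_partition[of n k] by simp
  then show False by (auto simp: trivial_partition_def)
qed

lemma inv_comp_transpose:
  assumes "\<alpha> permutes {1..n}"
  shows "inv (\<alpha> \<circ> transpose i j) = transpose i j \<circ> inv \<alpha>"
  using assms by (simp add: o_inv_distrib permutes_bij)

lemma partition_adjacent_swap:
  assumes "\<alpha> permutes {1..n}" "k \<in> {1..<n}"
  shows "partition_adjacent n (swap_partition n k) \<alpha> (\<alpha> \<circ> transpose k (Suc k))"
  unfolding partition_adjacent_def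
    block_reversal_swap_partition[OF assms(2)] inv_comp_transpose[OF assms(1)]
  using ordered_partition_swap_partition[OF assms(2)] swap_partition_nontrivial
    permutes_inv_o(2)[OF assms(1)] by (simp add: comp_assoc)

text \<open>Exchanging two consecutive positions changes no comparison except that between these
  two. Equality can fail, since for \<open>k\<close> outside \<open>{1..<n}\<close> the pair need
  not lie in the ground set.\<close>

lemma inversions_swap:
  assumes "\<alpha> permutes {1..n}"
  shows "inversions n \<alpha> (\<alpha> \<circ> transpose k (Suc k)) \<subseteq> {(\<alpha> k, \<alpha> (Suc k))}"
proof (rule subsetI, clarify)
  fix x y assume "(x, y) \<in> inversions n \<alpha> (\<alpha> \<circ> transpose k (Suc k))"
  then have "inv \<alpha> x < inv \<alpha> y" "transpose k (Suc k) (inv \<alpha> y) < transpose k (Suc k) (inv \<alpha> x)"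
    by (auto simp: inversions_def perm_less_def inv_comp_transpose[OF assms])
  then have "inv \<alpha> x = k" "inv \<alpha> y = Suc k" by (auto simp: transpose_def split: if_splits)
  then show "x = \<alpha> k \<and> y = \<alpha> (Suc k)" using permutes_inverses(1)[OF assms] by metis
qed

lemma perm_dist_swap:
  assumes "\<alpha> permutes {1..n}"
  shows "perm_dist n \<alpha> (\<alpha> \<circ> transpose k (Suc k)) \<le> 1"
  unfolding perm_dist_eq_card_inversions using card_mono[OF _ inversions_swap[OF assms]] by fastforce

text \<open>Exchanging neighbours that \<beta> has in the opposite order removes this inversion and
  creates no other.\<close>

lemma perm_dist_swap_less:
  assumes \<alpha>: "\<alpha> permutes {1..n}" and k: "(\<alpha> k, \<alpha> (Suc k)) \<in> inversions n \<alpha> \<beta>"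
  shows "perm_dist n (\<alpha> \<circ> transpose k (Suc k)) \<beta> < perm_dist n \<alpha> \<beta>"
proof -
  let ?\<alpha>' = "\<alpha> \<circ> transpose k (Suc k)"
  have "inversions n ?\<alpha>' \<beta> \<subseteq> inversions n \<alpha> \<beta>"
  proof (rule subsetI, clarify)
    fix x y assume xy: "(x, y) \<in> inversions n ?\<alpha>' \<beta>"
    show "(x, y) \<in> inversions n \<alpha> \<beta>"
    proof (rule ccontr)
      assume "(x, y) \<notin> inversions n \<alpha> \<beta>"
      moreover have "x \<noteq> y" using xy by (auto simp: inversions_def perm_less_def)
      then have "inv \<alpha> x \<noteq> inv \<alpha> y" using inv_permutes_eq_iff[OF \<alpha>] by simp
      \<comment> \<open>A newly created inversion must have been turned round by the exchange
        itself, so it is the exchanged pair; but \<beta> agrees with \<open>?\<alpha>'\<close> on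
        that pair.\<close>
      ultimately have "(y, x) \<in> inversions n \<alpha> ?\<alpha>'"
        using xy by (auto simp: inversions_def perm_less_def)
      then have "y = \<alpha> k" "x = \<alpha> (Suc k)" using inversions_swap[OF \<alpha>] by auto
      then show False using xy k by (auto simp: inversions_def perm_less_def)
    qed
  qed
  moreover have "(\<alpha> k, \<alpha> (Suc k)) \<notin> inversions n ?\<alpha>' \<beta>"
    using permutes_inverses(2)[OF \<alpha>]
    by (auto simp: inversions_def perm_less_def inv_comp_transpose[OF \<alpha>])
  ultimately have "inversions n ?\<alpha>' \<beta> \<subset> inversions n \<alpha> \<beta>" using k by blast
  then show ?thesis unfolding perm_dist_eq_card_inversions by (simp add: psubset_card_mono)
qed

lemma consecutive_inversion_exists:
  assumes \<alpha>: "\<alpha> permutes {1..n}" and \<beta>: "\<beta> permutes {1..n}" and "\<alpha> \<noteq> \<beta>"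
  obtains k where "k \<in> {1..<n}" "(\<alpha> k, \<alpha> (Suc k)) \<in> inversions n \<alpha> \<beta>"
proof -
  \<comment> \<open>\<open>f\<close> sends the position of an element in \<alpha> to its position in
    \<beta>, so the inversion sought is a descent of \<open>f\<close>.\<close>
  define f where "f = inv \<beta> \<circ> \<alpha>"
  have f: "f permutes {1..n}" unfolding f_def by (rule permutes_compose[OF \<alpha> permutes_inv[OF \<beta>]])
  have "\<exists>k\<in>{1..<n}. f (Suc k) < f k"
  proof (rule ccontr)
    assume no: "\<not> ?thesis"
    have step: "f k < f (Suc k)" if "k \<in> {1..<n}" for k
      using no that inj_eq[OF permutes_inj[OF f], of k "Suc k"] by force
    \<comment> \<open>Without descents \<open>f\<close> is strictly increasing on
      \<open>{1..n}\<close> and starts at a value of at least 1. A permutation that nowhere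
      decreases its argument is the identity.\<close>
    have "k \<in> {1..n} \<longrightarrow> k \<le> f k" for k
    proof (induction k)
      case (Suc k)
      show ?case
      proof (cases "k = 0")
        case True
        then show ?thesis using permutes_in_image[OF f, of 1] by auto
      next
        case False
        then show ?thesis using Suc step[of k] by auto
      qed
    qed simp
    then have "f = id" using permutes_natset_ge[OF f] by blast
    then have "\<beta> \<circ> (inv \<beta> \<circ> \<alpha>) = \<beta>" by (simp add: f_def)
    then have "\<alpha> = \<beta>" using permutes_inv_o(1)[OF \<beta>] by (simp add: o_assoc)
    then show False using \<open>\<alpha> \<noteq> \<beta>\<close> by simp
  qed
  then obtain k where k: "k \<in> {1..<n}" "f (Suc k) < f k" by blast
  have "\<alpha> k \<in> {1..n}" "\<alpha> (Suc k) \<in> {1..n}"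
    using k(1) permutes_in_image[OF \<alpha>, of k] permutes_in_image[OF \<alpha>, of "Suc k"] by simp_all
  then have "(\<alpha> k, \<alpha> (Suc k)) \<in> inversions n \<alpha> \<beta>"
    using k permutes_inverses(2)[OF \<alpha>] by (simp add: inversions_def perm_less_def f_def)
  then show thesis using that k by blast
qed

section \<open>Sorting walks and their weight\<close>

lemma pair_wf_big_permutograph: "pair_wf_digraph (big_permutograph n)"
  by unfold_locales (auto simp: big_permutograph_def)

definition walk_length :: "nat \<Rightarrow> ((nat \<Rightarrow> nat) \<times> (nat \<Rightarrow> nat)) list \<Rightarrow> nat" where
  "walk_length n p = (\<Sum>(\<alpha>, \<beta>)\<leftarrow>p. perm_dist n \<alpha> \<beta>)"

lemma walk_length_simps [simp]:
  "walk_length n [] = 0"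
  "walk_length n ((\<alpha>, \<beta>) # p) = perm_dist n \<alpha> \<beta> + walk_length n p"
  by (simp_all add: walk_length_def)

lemma awalk_cost_edge_weight:
  fixes G :: "(nat \<Rightarrow> nat) pair_pre_digraph"
  assumes "wf_digraph (with_proj G)"
  shows "wf_digraph.awalk_cost (edge_weight n) p = real (walk_length n p)"
proof -
  interpret wf_digraph "with_proj G" by fact
  show ?thesis by (induction p) (auto simp: edge_weight_def)
qed

text \<open>This is bubble sort: each exchange of an inverted neighbouring pair costs at most 1 and
  brings the permutation at least 1 closer to \<beta>.\<close>

lemma big_permutograph_walk:
  assumes "\<alpha> permutes {1..n}" "\<beta> permutes {1..n}"
  shows "\<exists>p. pre_digraph.awalk (with_proj (big_permutograph n)) \<alpha> p \<beta> \<and>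
             walk_length n p \<le> perm_dist n \<alpha> \<beta>"
  using assms(1)
proof (induction "perm_dist n \<alpha> \<beta>" arbitrary: \<alpha> rule: less_induct)
  case less
  interpret pair_wf_digraph "big_permutograph n" by (rule pair_wf_big_permutograph)
  show ?case
  proof (cases "\<alpha> = \<beta>")
    case True
    moreover have "\<beta> \<in> pverts (big_permutograph n)" using assms(2) by (simp add: big_permutograph_def)
    ultimately show ?thesis by (intro exI[of _ "[]"]) (simp add: awalk_Nil_iff)
  next
    case False
    then obtain k where k: "k \<in> {1..<n}" "(\<alpha> k, \<alpha> (Suc k)) \<in> inversions n \<alpha> \<beta>"
      using consecutive_inversion_exists[OF less.prems assms(2)] by blast
    define \<alpha>' where "\<alpha>' = \<alpha> \<circ> transpose k (Suc k)"
    have \<alpha>': "\<alpha>' permutes {1..n}" unfolding \<alpha>'_def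
      using k(1) less.prems by (intro permutes_compose permutes_swap_id) auto
    have lt: "perm_dist n \<alpha>' \<beta> < perm_dist n \<alpha> \<beta>"
      unfolding \<alpha>'_def by (rule perm_dist_swap_less[OF less.prems k(2)])
    obtain p where p: "awalk \<alpha>' p \<beta>" "walk_length n p \<le> perm_dist n \<alpha>' \<beta>"
      using less.hyps[OF lt \<alpha>'] by blast
    have "(\<alpha>, \<alpha>') \<in> parcs (big_permutograph n)"
      using less.prems \<alpha>' partition_adjacent_swap[OF less.prems k(1)]
      by (auto simp: big_permutograph_def perm_adjacent_def \<alpha>'_def)
    then have "awalk \<alpha> ((\<alpha>, \<alpha>') # p) \<beta>" using p(1) by (simp add: awalk_Cons_iff)
    moreover have "walk_length n ((\<alpha>, \<alpha>') # p) \<le> perm_dist n \<alpha> \<beta>"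
      using p(2) lt perm_dist_swap[OF less.prems, of k] by (simp add: \<alpha>'_def)
    ultimately show ?thesis by blast
  qed
qed

section \<open>Walks in a permutograph\<close>

locale permutograph_on =
  fixes n :: nat and H :: "(nat \<Rightarrow> nat) pair_pre_digraph"
  assumes is_permutograph: "permutograph n H"
begin

sublocale pair_graph H
  using is_permutograph by (simp add: permutograph_def)

lemma vertex_permutes: "\<alpha> \<in> pverts H \<Longrightarrow> \<alpha> permutes {1..n}"
  using is_permutograph by (auto simp: permutograph_def subgraph_def big_permutograph_def)

lemma arc_adjacent:
  assumes "(\<alpha>, \<beta>) \<in> parcs H"
  obtains \<pi> where "partition_adjacent n \<pi> \<alpha> \<beta>"
  using is_permutograph assms
  by (auto simp: permutograph_def subgraph_def big_permutograph_def perm_adjacent_def)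

text \<open>Isometry transfers the bound given by the sorting walk from the big permutograph to
  \<open>H\<close>, where the sorting walk itself may be missing.\<close>

lemma geodesic_exists:
  assumes "\<alpha> \<in> pverts H" "\<beta> \<in> pverts H"
  obtains p where "awalk \<alpha> p \<beta>" "walk_length n p \<le> perm_dist n \<alpha> \<beta>"
proof -
  interpret big: pair_wf_digraph "big_permutograph n" by (rule pair_wf_big_permutograph)
  obtain q where q: "big.awalk \<alpha> q \<beta>" "walk_length n q \<le> perm_dist n \<alpha> \<beta>"
    using big_permutograph_walk[OF vertex_permutes vertex_permutes] assms by blast
  have "\<mu> (edge_weight n) \<alpha> \<beta> = big.\<mu> (edge_weight n) \<alpha> \<beta>"
    using is_permutograph assms by (simp add: permutograph_def)
  also have "\<dots> \<le> real (walk_length n q)"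
    using big.min_cost_le_walk_cost[OF q(1), of "edge_weight n"]
    by (simp add: awalk_cost_edge_weight[OF big.wf_digraph_axioms])
  \<comment> \<open>An infimum yields a walk only below a strict upper bound, hence the added 1; as
    weights are integers, it is removed again at the end.\<close>
  also have "\<dots> < ereal (real (perm_dist n \<alpha> \<beta>) + 1)" using q(2) by simp
  finally obtain p where "awalk \<alpha> p \<beta>" "real (walk_length n p) < real (perm_dist n \<alpha> \<beta>) + 1"
    unfolding \<mu>_def by (auto simp: INF_less_iff awalk_cost_edge_weight[OF wf_digraph_axioms])
  then show thesis using that[of p] by linarith
qed

lemma perm_dist_le_walk_length:
  assumes "awalk \<alpha> p \<beta>"
  shows "perm_dist n \<alpha> \<beta> \<le> walk_length n p"
  using assms
proof (induction p arbitrary: \<alpha>)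
  case Nil
  moreover have "inversions n \<beta> \<beta> = {}" by (auto simp: inversions_def perm_less_def)
  ultimately show ?case by (simp add: perm_dist_eq_card_inversions awalk_Nil_iff)
next
  case (Cons e p)
  obtain \<gamma> where e: "e = (\<alpha>, \<gamma>)" "\<gamma> \<in> pverts H" and w: "awalk \<gamma> p \<beta>"
    using Cons.prems by (cases e) (auto simp: awalk_Cons_iff wellformed')
  show ?case
    using perm_dist_triangle[OF vertex_permutes[OF e(2)], of \<alpha> \<beta>] Cons.IH[OF w] by (simp add: e(1))
qed

text \<open>Induction on the walk: if its first arc leads to \<gamma> and \<open>u\<close> separates
  \<gamma> from \<beta>, then either \<open>u\<close> or \<open>F \<alpha>\<close> separates
  \<alpha> from \<beta>.\<close>

lemma separation_along_geodesic:
  assumes lin: "discrete_piecewise_linear n (pverts H) F" and F: "F \<in> pverts H \<rightarrow> {1..n}"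
    and "awalk \<alpha> p \<beta>" "walk_length n p \<le> perm_dist n \<alpha> \<beta>"
  shows "\<exists>u\<in>{1..n}. perm_le \<alpha> u (F \<alpha>) \<and> perm_le \<beta> (F \<beta>) u"
  using assms(3,4)
proof (induction p arbitrary: \<alpha>)
  case Nil
  then have "\<alpha> = \<beta>" "\<alpha> \<in> pverts H" by (auto simp: awalk_Nil_iff)
  then show ?case using F by (intro bexI[of _ "F \<alpha>"]) (auto simp: perm_le_def)
next
  case (Cons e p)
  obtain \<gamma> where e: "e = (\<alpha>, \<gamma>)" "(\<alpha>, \<gamma>) \<in> parcs H" and w: "awalk \<gamma> p \<beta>"
    using Cons.prems(1) by (cases e) (auto simp: awalk_Cons_iff)
  have V: "\<alpha> \<in> pverts H" "\<gamma> \<in> pverts H" using e(2) wellformed' by blast+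
  note perm = vertex_permutes[OF V(1)] vertex_permutes[OF V(2)]
  have len: "perm_dist n \<alpha> \<gamma> + walk_length n p \<le> perm_dist n \<alpha> \<beta>"
    using Cons.prems(2) by (simp add: e(1))
  then have geodesic: "perm_dist n \<alpha> \<gamma> + perm_dist n \<gamma> \<beta> \<le> perm_dist n \<alpha> \<beta>"
    using perm_dist_le_walk_length[OF w] by linarith
  \<comment> \<open>The rest of the walk is again short enough for the induction hypothesis: its
    weight is at most \<open>perm_dist n \<alpha> \<beta> - perm_dist n \<alpha> \<gamma>\<close>,
    hence at most \<open>perm_dist n \<gamma> \<beta>\<close>.\<close>
  obtain u where u: "u \<in> {1..n}" "perm_le \<gamma> u (F \<gamma>)" "perm_le \<beta> (F \<beta>) u"
    using Cons.IH[OF w] len perm_dist_triangle[OF perm(2), of \<alpha> \<beta>] by auto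
  show ?case
  proof (cases "perm_le \<alpha> u (F \<alpha>)")
    case True
    then show ?thesis using u by blast
  next
    case False
    obtain \<pi> where \<pi>: "partition_adjacent n \<pi> \<alpha> \<gamma>" using arc_adjacent[OF e(2)] .
    then have op: "ordered_partition n \<pi>" by (simp add: partition_adjacent_def)
    obtain i where i: "i < length \<pi>" "inv \<alpha> (F \<alpha>) \<in> \<pi> ! i" "inv \<gamma> (F \<gamma>) \<in> \<pi> ! i"
      using lin V \<pi> in_image_permutes_iff[OF perm(1)] in_image_permutes_iff[OF perm(2)]
      unfolding discrete_piecewise_linear_def by metis
    note same = partition_adjacent_block_iff[OF \<pi> perm(1)]
    have "inv \<alpha> u \<in> {1..n}" using u(1) permutes_in_image[OF permutes_inv[OF perm(1)]] by blast
    then obtain j where j: "j < length \<pi>" "inv \<alpha> u \<in> \<pi> ! j" using ordered_partition_block[OF op] by blast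
    have ju: "inv \<gamma> u \<in> \<pi> ! j" using same[of "\<pi> ! j"] j by simp
    \<comment> \<open>One inequality is read in \<gamma>, where \<open>u\<close> is at most
      \<open>F \<gamma>\<close>, the other in \<alpha>, where \<open>F \<alpha>\<close> precedes
      \<open>u\<close>. So \<open>u\<close> and \<open>F \<alpha>\<close> share a block, and the arc
      reverses them.\<close>
    have "j \<le> i" using ordered_partition_nth_le[OF op j(1) ju i(3)] u(2) by (simp add: perm_le_def)
    moreover have "i \<le> j"
      using ordered_partition_nth_le[OF op i(1,2) j(2)] False by (simp add: perm_le_def)
    ultimately have "inv \<alpha> u \<in> \<pi> ! i" using j(2) by simp
    then have "inv \<gamma> u < inv \<gamma> (F \<alpha>)"
      unfolding partition_adjacent_inv[OF \<pi> perm(1)]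
      using block_reversal_reverses[OF op _ i(2)] i(1) False by (simp add: perm_le_def)
    then have "(F \<alpha>, u) \<in> inversions n \<alpha> \<gamma>"
      using False u(1) F V(1) by (auto simp: inversions_def perm_less_def perm_le_def)
    \<comment> \<open>The geodesic keeps this pair reversed up to \<beta>. There
      \<open>F \<beta>\<close> is at most \<open>u\<close>, which is at most
      \<open>F \<alpha>\<close>, so \<open>F \<alpha>\<close> is the new witness.\<close>
    then have "perm_le \<beta> u (F \<alpha>)" by (rule inversion_on_geodesic_not_undone[OF perm(2) geodesic])
    then show ?thesis using u(3) F V(1)
      by (intro bexI[of _ "F \<alpha>"]) (auto simp: perm_le_def)
  qed
qed

lemma piecewise_linear_imp_separation:
  assumes "discrete_piecewise_linear n (pverts H) F" "F \<in> pverts H \<rightarrow> {1..n}"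
  shows "separation_property n (pverts H) F"
  unfolding separation_property_def
  using separation_along_geodesic[OF assms] geodesic_exists by metis

end

section \<open>From separation to common blocks\<close>

lemma separation_imp_piecewise_linear:
  assumes S: "\<And>\<alpha>. \<alpha> \<in> S \<Longrightarrow> \<alpha> permutes {1..n}" and F: "F \<in> S \<rightarrow> {1..n}"
    and sep: "separation_property n S F"
  shows "discrete_piecewise_linear n S F"
  unfolding discrete_piecewise_linear_def
proof (intro ballI allI impI)
  fix \<alpha> \<beta> \<pi> assume V: "\<alpha> \<in> S" "\<beta> \<in> S" and \<pi>: "partition_adjacent n \<pi> \<alpha> \<beta>"
  note perm = S[OF V(1)] S[OF V(2)]
  have op: "ordered_partition n \<pi>" using \<pi> by (simp add: partition_adjacent_def)
  have block: "\<exists>i<length \<pi>. inv \<alpha> x \<in> \<pi> ! i \<and> inv \<beta> x \<in> \<pi> ! i" if "x \<in> {1..n}" for x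
  proof -
    have "inv \<alpha> x \<in> {1..n}" using that permutes_in_image[OF permutes_inv[OF perm(1)]] by blast
    then show ?thesis
      using ordered_partition_block[OF op] partition_adjacent_block_iff[OF \<pi> perm(1)] nth_mem by metis
  qed
  obtain u v where u: "u \<in> {1..n}" "perm_le \<alpha> u (F \<alpha>)" "perm_le \<beta> (F \<beta>) u"
      and v: "v \<in> {1..n}" "perm_le \<beta> v (F \<beta>)" "perm_le \<alpha> (F \<alpha>) v"
    using sep V unfolding separation_property_def by meson
  have FX: "F \<alpha> \<in> {1..n}" "F \<beta> \<in> {1..n}" using F V by auto
  obtain i where i: "i < length \<pi>" "inv \<alpha> (F \<alpha>) \<in> \<pi> ! i" using block[OF FX(1)] by blast
  obtain j where j: "j < length \<pi>" "inv \<beta> (F \<beta>) \<in> \<pi> ! j" using block[OF FX(2)] by blast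
  obtain k where k: "k < length \<pi>" "inv \<alpha> u \<in> \<pi> ! k" "inv \<beta> u \<in> \<pi> ! k" using block[OF u(1)] by blast
  obtain l where l: "l < length \<pi>" "inv \<alpha> v \<in> \<pi> ! l" "inv \<beta> v \<in> \<pi> ! l" using block[OF v(1)] by blast
  note le = ordered_partition_nth_le[OF op]
  \<comment> \<open>The block indices of \<open>F \<beta>\<close>, \<open>u\<close>,
    \<open>F \<alpha>\<close>, \<open>v\<close> form a closed cycle of inequalities, read in
    \<beta>, \<alpha>, \<alpha>, \<beta> respectively, so all four coincide.\<close>
  have "j \<le> k" "k \<le> i" "i \<le> l" "l \<le> j"
    using le[OF j k(3)] le[OF k(1,2) i(2)] le[OF i l(2)] le[OF l(1,3) j(2)] u v
    by (simp_all add: perm_le_def)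
  then have "i = j" by simp
  then show "\<exists>i<length \<pi>. F \<alpha> \<in> \<alpha> ` (\<pi> ! i) \<and> F \<beta> \<in> \<beta> ` (\<pi> ! i)"
    unfolding in_image_permutes_iff[OF perm(1)] in_image_permutes_iff[OF perm(2)] using i j by blast
qed

section \<open>Polynomials\<close>

text \<open>The supremum is a choice among least upper bounds. A maximum of \<open>A\<close> is one,
  and it is the only one because \<open>inv \<alpha>\<close> is injective.\<close>

lemma sup_perm_order_eqI:
  assumes "\<alpha> permutes {1..n}" "A \<subseteq> {1..n}" "m \<in> A" "\<And>a. a \<in> A \<Longrightarrow> perm_le \<alpha> a m"
  shows "\<Squnion>\<^bsub>perm_order n \<alpha>\<^esub> A = m"
  unfolding sup_def
proof (rule some_equality)
  show least: "least (perm_order n \<alpha>) m (Upper (perm_order n \<alpha>) A)"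
    using assms by (auto simp: least_def Upper_def perm_order_def)
  fix x assume "least (perm_order n \<alpha>) x (Upper (perm_order n \<alpha>) A)"
  with least have "perm_le \<alpha> x m" "perm_le \<alpha> m x"
    by (auto simp: least_def perm_order_def)
  then show "x = m" using inv_permutes_eq_iff[OF assms(1)] by (simp add: perm_le_def)
qed

lemma inf_perm_order_eqI:
  assumes "\<alpha> permutes {1..n}" "A \<subseteq> {1..n}" "m \<in> A" "\<And>a. a \<in> A \<Longrightarrow> perm_le \<alpha> m a"
  shows "\<Sqinter>\<^bsub>perm_order n \<alpha>\<^esub> A = m"
  unfolding inf_def
proof (rule some_equality)
  show greatest: "greatest (perm_order n \<alpha>) m (Lower (perm_order n \<alpha>) A)"
    using assms by (auto simp: greatest_def Lower_def perm_order_def)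
  fix x assume "greatest (perm_order n \<alpha>) x (Lower (perm_order n \<alpha>) A)"
  with greatest have "perm_le \<alpha> x m" "perm_le \<alpha> m x"
    by (auto simp: greatest_def perm_order_def)
  then show "x = m" using inv_permutes_eq_iff[OF assms(1)] by (simp add: perm_le_def)
qed

text \<open>In a finite linear order the join of a nonempty set is its maximum, here the element
  with the largest position in \<alpha>.\<close>

lemma sup_perm_order_max:
  assumes "\<alpha> permutes {1..n}" "A \<subseteq> {1..n}" "A \<noteq> {}"
  shows "\<Squnion>\<^bsub>perm_order n \<alpha>\<^esub> A \<in> A" "a \<in> A \<Longrightarrow> perm_le \<alpha> a (\<Squnion>\<^bsub>perm_order n \<alpha>\<^esub> A)"
proof -
  have fin: "finite (inv \<alpha> ` A)" using finite_subset[OF assms(2)] by simp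
  then obtain m where m: "m \<in> A" "inv \<alpha> m = Max (inv \<alpha> ` A)"
    using Max_in[OF fin] assms(3) by (metis image_iff image_is_empty)
  have le: "perm_le \<alpha> a m" if "a \<in> A" for a using that fin by (simp add: perm_le_def m(2))
  have eq: "\<Squnion>\<^bsub>perm_order n \<alpha>\<^esub> A = m" using sup_perm_order_eqI[OF assms(1,2) m(1) le] .
  show "\<Squnion>\<^bsub>perm_order n \<alpha>\<^esub> A \<in> A" "a \<in> A \<Longrightarrow> perm_le \<alpha> a (\<Squnion>\<^bsub>perm_order n \<alpha>\<^esub> A)"
    unfolding eq using m(1) le by auto
qed

lemma inf_perm_order_min:
  assumes "\<alpha> permutes {1..n}" "A \<subseteq> {1..n}" "A \<noteq> {}"
  shows "\<Sqinter>\<^bsub>perm_order n \<alpha>\<^esub> A \<in> A" "a \<in> A \<Longrightarrow> perm_le \<alpha> (\<Sqinter>\<^bsub>perm_order n \<alpha>\<^esub> A) a"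
proof -
  have fin: "finite (inv \<alpha> ` A)" using finite_subset[OF assms(2)] by simp
  then obtain m where m: "m \<in> A" "inv \<alpha> m = Min (inv \<alpha> ` A)"
    using Min_in[OF fin] assms(3) by (metis image_iff image_is_empty)
  have le: "perm_le \<alpha> m a" if "a \<in> A" for a using that fin by (simp add: perm_le_def m(2))
  have eq: "\<Sqinter>\<^bsub>perm_order n \<alpha>\<^esub> A = m" using inf_perm_order_eqI[OF assms(1,2) m(1) le] .
  show "\<Sqinter>\<^bsub>perm_order n \<alpha>\<^esub> A \<in> A" "a \<in> A \<Longrightarrow> perm_le \<alpha> (\<Sqinter>\<^bsub>perm_order n \<alpha>\<^esub> A) a"
    unfolding eq using m(1) le by auto
qed

lemma polynomial_value_eq:
  "(SSUP\<^bsub>perm_order n \<alpha>\<^esub> K:\<K>. IINF\<^bsub>perm_order n \<alpha>\<^esub> j:K. const_fn j \<alpha>) =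
     \<Squnion>\<^bsub>perm_order n \<alpha>\<^esub> ((\<lambda>K. \<Sqinter>\<^bsub>perm_order n \<alpha>\<^esub> K) ` \<K>)"
  by (simp add: supr_def infi_def const_fn_def)

lemma separation_imp_polynomial:
  assumes n: "n \<ge> 1" and S: "\<And>\<alpha>. \<alpha> \<in> S \<Longrightarrow> \<alpha> permutes {1..n}" and F: "F \<in> S \<rightarrow> {1..n}"
    and sep: "separation_property n S F"
  shows "polynomial_on n S F"
proof (cases "S = {}")
  case True
  \<comment> \<open>A family indexed by \<open>S\<close> would be empty here, so an arbitrary
    admissible one is taken; \<open>{1}\<close> is a subset of the ground set because
    \<open>n \<ge> 1\<close>.\<close>
  then show ?thesis using n by (auto simp: polynomial_on_def intro!: exI[of _ "{{1}}"])
next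
  case False
  \<comment> \<open>\<open>K \<beta>\<close> is the up-set of \<open>F \<beta>\<close> in the order
    of \<beta>. Its meet at \<beta> is \<open>F \<beta>\<close>, and at any other \<alpha> it
    contains a separating element, which keeps its meet below \<open>F \<alpha>\<close>.\<close>
  define K where "K \<beta> = {u \<in> {1..n}. perm_le \<beta> (F \<beta>) u}" for \<beta>
  have K: "F \<beta> \<in> K \<beta>" "K \<beta> \<subseteq> {1..n}" if "\<beta> \<in> S" for \<beta>
    using F that by (auto simp: K_def perm_le_def)
  then have K_ne: "K \<beta> \<noteq> {}" if "\<beta> \<in> S" for \<beta> using that by blast
  have "F \<alpha> = \<Squnion>\<^bsub>perm_order n \<alpha>\<^esub> ((\<lambda>K. \<Sqinter>\<^bsub>perm_order n \<alpha>\<^esub> K) ` K ` S)" if \<alpha>: "\<alpha> \<in> S" for \<alpha>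
  proof (rule sup_perm_order_eqI[symmetric, OF S[OF \<alpha>]])
    have "\<Sqinter>\<^bsub>perm_order n \<alpha>\<^esub> (K \<alpha>) = F \<alpha>"
      by (rule inf_perm_order_eqI[OF S[OF \<alpha>] K(2,1)[OF \<alpha>]]) (simp add: K_def)
    then show "F \<alpha> \<in> (\<lambda>K. \<Sqinter>\<^bsub>perm_order n \<alpha>\<^esub> K) ` K ` S" using \<alpha> by (metis image_eqI)
    show "(\<lambda>K. \<Sqinter>\<^bsub>perm_order n \<alpha>\<^esub> K) ` K ` S \<subseteq> {1..n}"
      using inf_perm_order_min(1)[OF S[OF \<alpha>] K(2) K_ne] K(2) by blast
    fix a assume "a \<in> (\<lambda>K. \<Sqinter>\<^bsub>perm_order n \<alpha>\<^esub> K) ` K ` S"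
    then obtain \<beta> where \<beta>: "\<beta> \<in> S" and a: "a = \<Sqinter>\<^bsub>perm_order n \<alpha>\<^esub> (K \<beta>)" by blast
    obtain u where u: "u \<in> {1..n}" "perm_le \<alpha> u (F \<alpha>)" "perm_le \<beta> (F \<beta>) u"
      using sep \<alpha> \<beta> unfolding separation_property_def by meson
    then have "perm_le \<alpha> a u"
      unfolding a by (intro inf_perm_order_min(2)[OF S[OF \<alpha>] K(2)[OF \<beta>] K_ne[OF \<beta>]]) (simp_all add: K_def \<beta>)
    then show "perm_le \<alpha> a (F \<alpha>)" using u(2) by (simp add: perm_le_def)
  qed
  then show ?thesis unfolding polynomial_on_def polynomial_value_eq
    using K(2) K_ne False by (intro exI[of _ "K ` S"]) auto
qed

lemma polynomial_imp_separation:
  assumes S: "\<And>\<alpha>. \<alpha> \<in> S \<Longrightarrow> \<alpha> permutes {1..n}" and poly: "polynomial_on n S F"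
  shows "separation_property n S F"
  unfolding separation_property_def
proof (intro ballI)
  fix \<alpha> \<beta> assume \<alpha>: "\<alpha> \<in> S" and \<beta>: "\<beta> \<in> S"
  obtain \<K> where ne: "\<K> \<noteq> {}" and K: "\<And>K. K \<in> \<K> \<Longrightarrow> K \<noteq> {}" "\<And>K. K \<in> \<K> \<Longrightarrow> K \<subseteq> {1..n}"
    and F: "\<And>\<gamma>. \<gamma> \<in> S \<Longrightarrow> F \<gamma> = \<Squnion>\<^bsub>perm_order n \<gamma>\<^esub> ((\<lambda>K. \<Sqinter>\<^bsub>perm_order n \<gamma>\<^esub> K) ` \<K>)"
    using poly unfolding polynomial_on_def polynomial_value_eq by metis
  note inf = inf_perm_order_min[OF S K(2,1)]
  have sub: "(\<lambda>K. \<Sqinter>\<^bsub>perm_order n \<gamma>\<^esub> K) ` \<K> \<subseteq> {1..n}" if "\<gamma> \<in> S" for \<gamma>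
    using inf(1)[OF that] K(2) by blast
  note sup = sup_perm_order_max[OF S sub]
  \<comment> \<open>The join at \<beta> is a maximum, so some member of the family attains
    it.\<close>
  obtain K0 where K0: "K0 \<in> \<K>" "F \<beta> = \<Sqinter>\<^bsub>perm_order n \<beta>\<^esub> K0"
    using sup(1)[OF \<beta> \<beta>] ne F[OF \<beta>] by auto
  \<comment> \<open>At \<alpha> this meet is one of the joined terms, hence at most
    \<open>F \<alpha>\<close>; at \<beta> it is a member of \<open>K0\<close>, hence at least the
    meet \<open>F \<beta>\<close>.\<close>
  let ?u = "\<Sqinter>\<^bsub>perm_order n \<alpha>\<^esub> K0"
  have "?u \<in> K0" using inf(1)[OF \<alpha> K0(1) K0(1)] .
  moreover have "perm_le \<alpha> ?u (F \<alpha>)" using sup(2)[OF \<alpha> \<alpha>] K0(1) F[OF \<alpha>] by auto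
  moreover have "perm_le \<beta> (F \<beta>) ?u"
    unfolding K0(2) using inf(2)[OF \<beta> K0(1) K0(1) \<open>?u \<in> K0\<close>] .
  ultimately show "\<exists>u\<in>{1..n}. perm_le \<alpha> u (F \<alpha>) \<and> perm_le \<beta> (F \<beta>) u"
    using K(2)[OF K0(1)] by blast
qed

theorem theorem3:
  fixes n :: nat
    and H :: "(nat \<Rightarrow> nat) pair_pre_digraph"
    and F :: "(nat \<Rightarrow> nat) \<Rightarrow> nat"
  assumes "n \<ge> 1"
    and "permutograph n H"
    and "F \<in> pverts H \<rightarrow> {1..n}"
  shows "(discrete_piecewise_linear n (pverts H) F \<longleftrightarrow> separation_property n (pverts H) F) \<and>
         (separation_property n (pverts H) F \<longleftrightarrow> polynomial_on n (pverts H) F)"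
proof -
  interpret permutograph_on n H by unfold_locales (rule assms(2))
  show ?thesis
    using piecewise_linear_imp_separation[OF _ assms(3)]
      separation_imp_piecewise_linear[OF vertex_permutes assms(3)]
      separation_imp_polynomial[OF assms(1) vertex_permutes assms(3)]
      polynomial_imp_separation[OF vertex_permutes] by blast
qed

end
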